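(* Let $\Omega\subset\mathbb R^2$ be a strictly convex domain with smooth boundary of perimeter $1$, and let $\beta$ be the $\beta$-function of its billiard map, with expansion as $h\to0^+$ $$\beta(h)=\beta_1h+\frac{\beta_3}{3!}h^3+o(h^3).$$ Then $$\beta_3+\pi^2\beta_1\le0,$$ and equality holds if and only if $\Omega$ is a disc.
   Context: Let $\Omega\subset\mathbb R^2$ be a bounded strictly convex domain with smooth boundary of perimeter $1$ and everywhere positive curvature, and let $\xi:\mathbb R/\mathbb Z\to\partial\Omega$ be an arc-length parametrization. Put $h_\Omega(x,\bar x)=-\|\xi(x \bmod 1)-\xi(\bar x \bmod 1)\|$. The $\beta$-function $\beta:(0,1/2]\to\mathbb R$ of the billiard in $\Omega$ is defined as follows: for $p/q\in\mathbb Q\cap(0,1/2]$ in lowest terms, $\beta(p/q)=\frac1q\min\sum_{i=0}^{q-1}h_\Omega(x_i,x_{i+1})$, the minimum being over all real sequences $(x_0,\dots,x_q)$ with $x_q=x_0+p$ and $x_i\le x_{i+1}\le x_i+1$ for $0\le i<q$; for irrational $h\in(0,1/2]$, $\beta(h)=\lim_n\beta(p_n/q_n)$ for any rationals $p_n/q_n\to h$. It has an asymptotic expansion in odd powers of $h$ as $h\to0^+$. *)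

theory Defs
  imports "HOL-Analysis.Analysis" "HOL-Library.Landau_Symbols"
begin

definition strictly_convex :: "'a::real_normed_vector set \<Rightarrow> bool" where
  "strictly_convex S \<longleftrightarrow>
    (\<forall>x\<in>closure S. \<forall>y\<in>closure S. x \<noteq> y \<longrightarrow> open_segment x y \<subseteq> interior S)"

definition curve_deriv :: "(real \<Rightarrow> 'a::real_normed_vector) \<Rightarrow> real \<Rightarrow> 'a" where
  "curve_deriv f = (\<lambda>t. vector_derivative f (at t))"

text \<open>Smoothness of class \<open>C\<^sup>\<infinity>\<close>: every iterated derivative is differentiable everywhere.\<close>

definition smooth_curve :: "(real \<Rightarrow> 'a::real_normed_vector) \<Rightarrow> bool" where
  "smooth_curve f \<longleftrightarrow> (\<forall>k t. ((curve_deriv ^^ k) f) differentiable (at t))"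

text \<open>A map on the circle \<open>\<real>/\<int>\<close> is represented by its 1-periodic lift to \<open>\<real>\<close>.
  Injectivity on a period and unit speed force the closed curve \<open>C\<close> to have length 1.\<close>

definition arc_length_param :: "(real \<Rightarrow> real^2) \<Rightarrow> (real^2) set \<Rightarrow> bool" where
  "arc_length_param \<xi> C \<longleftrightarrow>
     smooth_curve \<xi> \<and> (\<forall>s. \<xi> (s + 1) = \<xi> s) \<and>
     inj_on \<xi> {0..<1} \<and> \<xi> ` {0..<1} = C \<and> (\<forall>s. norm (curve_deriv \<xi> s) = 1)"

text \<open>For a curve parametrized by arc length the curvature is the norm of the second derivative.
  On the boundary of a convex domain this is the signed curvature with respect to
  the inward normal.\<close>

definition curvature :: "(real \<Rightarrow> real^2) \<Rightarrow> real \<Rightarrow> real" where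
  "curvature \<xi> s = norm (curve_deriv (curve_deriv \<xi>) s)"

definition billiard_h :: "(real \<Rightarrow> real^2) \<Rightarrow> real \<Rightarrow> real \<Rightarrow> real" where
  "billiard_h \<xi> x y = - norm (\<xi> x - \<xi> y)"

text \<open>Only the entries with index at most \<open>q\<close> of a sequence are relevant.\<close>

definition pq_sequences :: "nat \<Rightarrow> nat \<Rightarrow> (nat \<Rightarrow> real) set" where
  "pq_sequences p q =
     {x. x q = x 0 + real p \<and> (\<forall>i<q. x i \<le> x (Suc i) \<and> x (Suc i) \<le> x i + 1)}"

definition action :: "(real \<Rightarrow> real^2) \<Rightarrow> nat \<Rightarrow> (nat \<Rightarrow> real) \<Rightarrow> real" where
  "action \<xi> q x = (\<Sum>i<q. billiard_h \<xi> (x i) (x (Suc i)))"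

text \<open>The infimum is a minimum; see \<open>minimal_action_attained\<close> below.\<close>

definition minimal_action :: "(real \<Rightarrow> real^2) \<Rightarrow> nat \<Rightarrow> nat \<Rightarrow> real" where
  "minimal_action \<xi> p q = (INF x\<in>pq_sequences p q. action \<xi> q x)"

definition billiard_beta_rat :: "(real \<Rightarrow> real^2) \<Rightarrow> real \<Rightarrow> real" where
  "billiard_beta_rat \<xi> h =
     (THE v. \<exists>p q. 0 < q \<and> coprime p q \<and> h = real p / real q \<and>
                   v = minimal_action \<xi> p q / real q)"

text \<open>The \<open>\<beta>\<close>-function; its values outside \<open>(0, 1/2]\<close> carry no meaning.\<close>

definition billiard_beta :: "(real \<Rightarrow> real^2) \<Rightarrow> real \<Rightarrow> real" where
  "billiard_beta \<xi> h =
     (if h \<in> \<rat> then billiard_beta_rat \<xi> h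
      else Lim (at h within (\<rat> \<inter> {0<..1/2})) (billiard_beta_rat \<xi>))"

lemma billiard_beta_rat_fraction:
  assumes "0 < q" "coprime p q"
  shows "billiard_beta \<xi> (real p / real q) = minimal_action \<xi> p q / real q"
proof -
  have "p' = p \<and> q' = q"
    if "0 < q'" "coprime p' q'" "real p / real q = real p' / real q'" for p' q' :: nat
  proof -
    have "real p * real q' = real p' * real q"
      using that assms by (simp add: field_simps)
    then have "p * q' = p' * q"
      by (metis of_nat_eq_iff of_nat_mult)
    with coprime_crossproduct_nat [of p q p' q'] that assms show ?thesis
      by (simp add: mult.commute)
  qed
  then have "billiard_beta_rat \<xi> (real p / real q) = minimal_action \<xi> p q / real q"
    unfolding billiard_beta_rat_def using assms by (intro the_equality) blast+
  then show ?thesis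
    by (simp add: billiard_beta_def)
qed

lemma periodic_add_of_int:
  assumes "\<And>s. f (s + 1) = f (s::real)"
  shows "f (s + of_int k) = f s"
proof (induction k rule: int_induct [where k = 0])
  case (step1 i)
  then show ?case using assms [of "s + of_int i"] by (simp add: add.assoc)
next
  case (step2 i)
  then show ?case using assms [of "s + of_int (i - 1)"] by (simp add: algebra_simps)
qed simp

lemma minimal_action_attained:
  assumes cont: "continuous_on UNIV \<xi>" and per: "\<And>s. \<xi> (s + 1) = \<xi> s" and "p \<le> q" "0 < q"
  shows "\<exists>x\<in>pq_sequences p q. action \<xi> q x = minimal_action \<xi> p q \<and>
           (\<forall>y\<in>pq_sequences p q. action \<xi> q x \<le> action \<xi> q y)"
proof -
  define K where "K = pq_sequences p q \<inter> (UNIV \<rightarrow>\<^sub>E {0..real q + 1})"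
  have coord: "continuous_on UNIV (\<lambda>x :: nat \<Rightarrow> real. x i)" for i
    by simp
  have eq: "pq_sequences p q = {x. x q = x 0 + real p} \<inter>
      (\<Inter>i\<in>{..<q}. {x. x i \<le> x (Suc i)} \<inter> {x. x (Suc i) \<le> x i + 1})"
    by (auto simp: pq_sequences_def)
  have "closed (pq_sequences p q)"
    unfolding eq
    by (intro closed_Int closed_INT ballI closed_Collect_eq closed_Collect_le
        continuous_intros coord)
  moreover have "compact ((UNIV :: nat set) \<rightarrow>\<^sub>E {0..real q + 1})"
  proof -
    have "compactin (product_topology (\<lambda>_::nat. euclidean) UNIV) (UNIV \<rightarrow>\<^sub>E {0..real q + 1})"
      by (subst compactin_PiE) auto
    then show ?thesis
      by (simp add: euclidean_product_topology)
  qed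
  ultimately have "compact K"
    unfolding K_def by (rule closed_Int_compact)
  have "(\<lambda>i. real i * (real p / real q)) \<in> pq_sequences p q"
    using \<open>p \<le> q\<close> \<open>0 < q\<close> by (auto simp: pq_sequences_def field_simps)
  moreover have norm: "\<exists>z\<in>K. action \<xi> q z = action \<xi> q y" if y: "y \<in> pq_sequences p q" for y
  proof -
    define z where "z = (\<lambda>i. if i \<le> q then y i + of_int (- \<lfloor>y 0\<rfloor>) else 0)"
    have bound: "0 \<le> z i \<and> z i \<le> real i + 1" if "i \<le> q" for i
      using that
    proof (induction i)
      case 0
      have "0 \<le> y 0 - of_int \<lfloor>y 0\<rfloor>" "y 0 - of_int \<lfloor>y 0\<rfloor> \<le> 1"
        by linarith+
      then show ?case by (simp add: z_def)
    next
      case (Suc i)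
      then have "y i \<le> y (Suc i)" "y (Suc i) \<le> y i + 1"
        using y by (auto simp: pq_sequences_def)
      with Suc show ?case by (auto simp: z_def)
    qed
    have "z \<in> UNIV \<rightarrow>\<^sub>E {0..real q + 1}"
    proof (rule PiE_I)
      fix i
      show "z i \<in> {0..real q + 1}"
      proof (cases "i \<le> q")
        case True
        then have "real i \<le> real q" by simp
        with bound [OF True] show ?thesis by auto
      qed (simp add: z_def)
    qed simp
    moreover have "z \<in> pq_sequences p q"
      using y by (auto simp: pq_sequences_def z_def)
    moreover have "action \<xi> q z = action \<xi> q y"
    proof -
      have "\<xi> (z i) = \<xi> (y i)" if "i \<le> q" for i
        using that periodic_add_of_int [of \<xi>, OF per, of "y i" "- \<lfloor>y 0\<rfloor>"]
        by (simp add: z_def del: of_int_minus)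
      then show ?thesis
        unfolding action_def billiard_h_def by (intro sum.cong) auto
    qed
    ultimately show ?thesis unfolding K_def by blast
  qed
  ultimately have "K \<noteq> {}" by blast
  moreover have "continuous_on K (action \<xi> q)"
    unfolding action_def billiard_h_def
    by (intro continuous_intros continuous_on_compose2 [OF cont]
        continuous_on_subset [OF coord]) auto
  ultimately obtain x where x: "x \<in> K" "\<And>z. z \<in> K \<Longrightarrow> action \<xi> q x \<le> action \<xi> q z"
    using continuous_attains_inf [OF \<open>compact K\<close>] by blast
  have le: "action \<xi> q x \<le> action \<xi> q y" if "y \<in> pq_sequences p q" for y
    using norm [OF that] x(2) by metis
  have mem: "x \<in> pq_sequences p q"
    using x(1) by (simp add: K_def)
  have "minimal_action \<xi> p q = action \<xi> q x"
    unfolding minimal_action_def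
    by (rule cInf_eq_minimum) (use mem le in auto)
  with mem le show ?thesis by auto
qed

end

theory Submission
  imports Defs "HOL-Real_Asymp.Real_Asymp"
begin

text \<open>
Write \<open>m q\<close> for the minimal action of rotation number \<open>1 / q\<close>, so that \<open>\<beta>(1/q) = m q / q\<close>.
Evaluating the expansion of \<open>\<beta>\<close> along \<open>h = 1 / q\<close> gives \<open>m q \<longrightarrow> \<beta>\<^sub>1\<close> and
\<open>q\<^sup>2 (m q - \<beta>\<^sub>1) \<longrightarrow> \<beta>\<^sub>3 / 6\<close>. A chord is no longer than its arc, hence \<open>m q \<ge> -1\<close>; the polygons
constructed below give \<open>m q \<le> -1 + O(q\<^sup>-\<^sup>2)\<close>. So \<open>\<beta>\<^sub>1 = -1\<close>, the claim is \<open>\<beta>\<^sub>3 \<le> \<pi>\<^sup>2\<close> with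
equality exactly for discs, and \<open>\<beta>\<^sub>3 / 6\<close> is the limit of \<open>q\<^sup>2 (m q + 1)\<close>
(\<open>minimal_action_expansion\<close>).

The classical formula is \<open>\<beta>\<^sub>3 = (\<integral>\<kappa>\<^bsup>2/3\<^esup>)\<^sup>3 / 4\<close>, and the inequality then is the Hoelder
inequality together with \<open>\<integral>\<kappa> = 2 \<pi>\<close>. But the inequality follows already from one good family of
polygons, without any knowledge of the minimizers. An arc of length \<open>l\<close> and maximal curvature
\<open>K\<close> exceeds its chord by at most \<open>K\<^sup>2 l\<^sup>3 / 24\<close> (\<open>chord_lower_bound\<close>). Distributing \<open>q\<close> vertices
with density \<open>\<rho>\<close> makes the arc at \<open>s\<close> about \<open>1 / (q \<rho>(s))\<close> long, so it contributes
\<open>\<kappa>\<^sup>2 / \<rho>\<^sup>3 / (24 q\<^sup>3)\<close>. The choice \<open>\<rho> = (2 k + 1) / 3\<close> with \<open>k = \<kappa> / (2 \<pi>)\<close> is a probability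
density because the total curvature is \<open>2 \<pi>\<close> (\<open>total_curvature\<close>), and the inequality between the
geometric and the arithmetic mean of \<open>k\<close>, \<open>k\<close> and \<open>1\<close> says \<open>k\<^sup>2 \<le> \<rho>\<^sup>3\<close>. Hence
\<open>\<kappa>\<^sup>2 / \<rho>\<^sup>3 \<le> 4 \<pi>\<^sup>2\<close> holds pointwise, with equality only where \<open>k = 1\<close>. Adding the \<open>q\<close>
contributions gives \<open>\<beta>\<^sub>3 \<le> \<pi>\<^sup>2\<close> (\<open>cubic_coefficient_le\<close>), and the inequality is strict as soon
as \<open>\<kappa> \<noteq> 2 \<pi>\<close> at one point, because then a positive proportion of the arcs does better
(\<open>cubic_coefficient_less_if_noncircular\<close>).

If \<open>\<beta>\<^sub>3 = \<pi>\<^sup>2\<close>, the curvature is therefore constant, the boundary lies on a circle and the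
domain is a disc. Conversely, in a disc of perimeter 1 the chord over an arc of length \<open>l\<close> is
\<open>sin (\<pi> l) / \<pi>\<close>; concavity of the sine shows that no polygon is longer than the regular one, and
its length expands as \<open>1 - \<pi>\<^sup>2 / (6 q\<^sup>2)\<close> up to smaller terms
(\<open>cubic_coefficient_ge_if_circular\<close>).
\<close>

section \<open>The quarter turn of the plane\<close>

definition perp :: "real^2 \<Rightarrow> real^2" where
  "perp v = vector [- (v $ 2), v $ 1]"

lemma perp_inner [simp]: "v \<bullet> perp v = 0" "perp v \<bullet> v = 0" "perp v \<bullet> perp w = v \<bullet> w"
  by (simp_all add: perp_def inner_vec_def sum_2)

lemma perp_antisym: "perp v \<bullet> w = - (v \<bullet> perp w)"
  by (simp add: perp_def inner_vec_def sum_2)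

lemma perp_perp [simp]: "perp (perp v) = - v"
  by (simp add: perp_def vec_eq_iff forall_2)

lemma norm_perp [simp]: "norm (perp v) = norm v"
  by (simp add: norm_eq_sqrt_inner)

lemma bounded_linear_perp: "bounded_linear perp"
  by (auto simp: linear_conv_bounded_linear [symmetric] perp_def vec_eq_iff forall_2
      intro!: linearI)

lemma orthonormal_expansion:
  assumes "norm t = 1"
  shows "v = (v \<bullet> t) *\<^sub>R t + (v \<bullet> perp t) *\<^sub>R perp t"
proof -
  have t: "(t$1) * (t$1) + (t$2) * (t$2) = 1"
    using assms by (simp add: norm_eq_1 inner_vec_def sum_2)
  have "v$1 = v$1 * ((t$1) * (t$1) + (t$2) * (t$2))"
    "v$2 = v$2 * ((t$1) * (t$1) + (t$2) * (t$2))"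
    using t by simp_all
  then show ?thesis
    by (simp add: perp_def vec_eq_iff forall_2 inner_vec_def sum_2 algebra_simps)
qed

section \<open>Closed curves of unit speed and nonvanishing curvature\<close>

lemma global_antiderivative:
  fixes f :: "real \<Rightarrow> real"
  assumes "continuous_on UNIV f"
  obtains F where "F 0 = 0" "\<And>s. (F has_real_derivative f s) (at s)"
proof -
  define F where "F = (\<lambda>s. LBINT y=ereal 0..ereal s. f y)"
  have "(F has_real_derivative f s) (at s)" for s
  proof -
    have "(F has_vector_derivative f s) (at s within {- \<bar>s\<bar> - 1..\<bar>s\<bar> + 1})"
      unfolding F_def using assms
      by (intro interval_integral_FTC2) (auto intro: continuous_on_subset)
    then show ?thesis
      by (simp add: at_within_Icc_at has_real_derivative_iff_has_vector_derivative)
  qed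
  then show thesis
    by (intro that [of F]) (simp_all add: F_def)
qed

text \<open>
The velocity \<open>T\<close> and the acceleration \<open>A\<close> are parameters rather than derivatives computed from
\<open>\<xi>\<close>, so that the differentiation rules apply to them directly.
\<close>

locale regular_closed_curve =
  fixes \<xi> T A :: "real \<Rightarrow> real^2"
  assumes velocity: "(\<xi> has_vector_derivative T s) (at s)"
    and acceleration: "(T has_vector_derivative A s) (at s)"
    and continuous_acceleration: "continuous_on UNIV A"
    and periodic: "\<xi> (s + 1) = \<xi> s"
    and unit_speed: "norm (T s) = 1"
    and curved: "A s \<noteq> 0"
begin

definition \<kappa> :: "real \<Rightarrow> real" where "\<kappa> s = norm (A s)"

lemma curvature_pos: "\<kappa> s > 0"
  by (simp add: \<kappa>_def curved)

lemma continuous_curvature: "continuous_on S \<kappa>"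
  unfolding \<kappa>_def
  by (intro continuous_intros continuous_on_subset [OF continuous_acceleration]) auto

lemma periodic_velocity: "T (s + 1) = T s"
proof -
  have "((\<xi> \<circ> (\<lambda>s. s + 1)) has_vector_derivative (1 *\<^sub>R T (s + 1))) (at s)"
    by (rule vector_diff_chain_at) (auto intro!: derivative_eq_intros velocity)
  then have "(\<xi> has_vector_derivative T (s + 1)) (at s)"
    by (simp add: o_def periodic)
  then show ?thesis
    using velocity [of s] by (rule vector_derivative_unique_at)
qed

lemma periodic_acceleration: "A (s + 1) = A s"
proof -
  have "((T \<circ> (\<lambda>s. s + 1)) has_vector_derivative (1 *\<^sub>R A (s + 1))) (at s)"
    by (rule vector_diff_chain_at) (auto intro!: derivative_eq_intros acceleration)
  then have "(T has_vector_derivative A (s + 1)) (at s)"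
    by (simp add: o_def periodic_velocity)
  then show ?thesis
    using acceleration [of s] by (rule vector_derivative_unique_at)
qed

lemma continuous_position: "continuous_on UNIV \<xi>"
  by (meson continuous_on_eq_continuous_within has_vector_derivative_continuous
      continuous_at_imp_continuous_at_within velocity)

lemma continuous_velocity: "continuous_on S T"
  by (meson acceleration continuous_on_eq_continuous_within continuous_on_subset
      has_vector_derivative_continuous subset_UNIV)

lemma DERIV_inner_position: "((\<lambda>s. \<xi> s \<bullet> v) has_real_derivative T s \<bullet> v) (at s)"
  using bounded_linear.has_vector_derivative [OF bounded_linear_inner_left velocity]
  by (simp add: has_real_derivative_iff_has_vector_derivative)

lemma DERIV_inner_velocity: "((\<lambda>s. T s \<bullet> v) has_real_derivative A s \<bullet> v) (at s)"
  using bounded_linear.has_vector_derivative [OF bounded_linear_inner_left acceleration]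
  by (simp add: has_real_derivative_iff_has_vector_derivative)

lemma acceleration_orthogonal: "A s \<bullet> T s = 0"
proof -
  have "((\<lambda>s. T s \<bullet> T s) has_real_derivative 2 * (A s \<bullet> T s)) (at s)"
    using bounded_bilinear.has_vector_derivative
      [OF bounded_bilinear_inner acceleration acceleration, of s]
    by (simp add: has_real_derivative_iff_has_vector_derivative inner_commute)
  moreover have "(\<lambda>s. T s \<bullet> T s) = (\<lambda>s. 1)"
    using unit_speed by (auto simp: norm_eq_1)
  ultimately have "((\<lambda>s. 1::real) has_real_derivative 2 * (A s \<bullet> T s)) (at s)"
    by simp
  then show ?thesis
    using DERIV_const DERIV_unique by fastforce
qed

text \<open>
The acceleration is a multiple of the normal \<open>perp (T s)\<close> because the speed is constant. The factor is
continuous and never vanishes, so it has the same sign everywhere: the sign depends on the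
orientation only.
\<close>

lemma frenet:
  obtains \<epsilon> :: real where "\<epsilon> = 1 \<or> \<epsilon> = -1" "\<And>s. A s = (\<epsilon> * \<kappa> s) *\<^sub>R perp (T s)"
proof -
  define \<sigma> where "\<sigma> s = A s \<bullet> perp (T s)" for s
  have A: "A s = \<sigma> s *\<^sub>R perp (T s)" for s
    using orthonormal_expansion [OF unit_speed, of "A s" s]
    by (simp add: acceleration_orthogonal \<sigma>_def)
  have abs: "\<bar>\<sigma> s\<bar> = \<kappa> s" for s
    by (subst \<kappa>_def, subst A) (simp add: unit_speed)
  have "continuous_on UNIV \<sigma>"
    unfolding \<sigma>_def
    by (intro continuous_intros continuous_acceleration continuous_velocity
        linear_continuous_on_compose [OF _ bounded_linear.linear [OF bounded_linear_perp]])
  then have conn: "connected (range \<sigma>)"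
    by (intro connected_continuous_image) auto
  have "0 \<notin> range \<sigma>"
    using abs curvature_pos by (metis abs_zero imageE less_irrefl)
  then have "(\<forall>s. \<sigma> s > 0) \<or> (\<forall>s. \<sigma> s < 0)"
    using conn unfolding connected_iff_interval
    by (metis linorder_neqE_linordered_idom less_imp_le rangeI)
  then have "\<exists>\<epsilon>. (\<epsilon> = 1 \<or> \<epsilon> = - 1) \<and> (\<forall>s. \<sigma> s = \<epsilon> * \<kappa> s)"
  proof
    assume "\<forall>s. \<sigma> s > 0"
    then have "\<forall>s. \<sigma> s = 1 * \<kappa> s" using abs by (metis abs_of_pos mult_1)
    then show ?thesis by blast
  next
    assume "\<forall>s. \<sigma> s < 0"
    then have "\<forall>s. \<sigma> s = - 1 * \<kappa> s" using abs by (metis abs_of_neg minus_minus mult_minus1)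
    then show ?thesis by blast
  qed
  then show ?thesis using A that by metis
qed

text \<open>
The angle through which the tangent has turned since parameter 0, counted positively in the
direction of turning.
\<close>

definition \<alpha> :: "real \<Rightarrow> real" where
  "\<alpha> = (SOME F. F 0 = 0 \<and> (\<forall>s. (F has_real_derivative \<kappa> s) (at s)))"

lemma angle_zero: "\<alpha> 0 = 0" and DERIV_angle: "(\<alpha> has_real_derivative \<kappa> s) (at s)"
proof -
  obtain F where "F 0 = 0 \<and> (\<forall>s. (F has_real_derivative \<kappa> s) (at s))"
    using global_antiderivative [OF continuous_curvature] by metis
  then have "\<exists>F. F 0 = 0 \<and> (\<forall>s. (F has_real_derivative \<kappa> s) (at s))"
    by (rule exI [where x = F])
  from someI_ex [OF this] have "\<alpha> 0 = 0 \<and> (\<forall>s. (\<alpha> has_real_derivative \<kappa> s) (at s))"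
    by (simp add: \<alpha>_def)
  then show "\<alpha> 0 = 0" "(\<alpha> has_real_derivative \<kappa> s) (at s)" by auto
qed

lemma angle_strict_mono: "x < y \<Longrightarrow> \<alpha> x < \<alpha> y"
  using DERIV_pos_imp_increasing [of x y \<alpha>] DERIV_angle curvature_pos by blast

lemma angle_shift: "\<alpha> (s + 1) = \<alpha> s + \<alpha> 1"
proof -
  have "((\<lambda>s. \<alpha> (s + 1) - \<alpha> s) has_real_derivative 0) (at s)" for s
    using DERIV_diff [OF _ DERIV_angle, of "\<lambda>s. \<alpha> (s + 1)" "\<kappa> (s + 1)" s] DERIV_angle [of "s + 1"]
    by (simp add: DERIV_shift \<kappa>_def periodic_acceleration)
  then have "\<alpha> (s + 1) - \<alpha> s = \<alpha> (0 + 1) - \<alpha> 0"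
    by (rule DERIV_isconst_all [rule_format])
  then show ?thesis by (simp add: angle_zero)
qed

text \<open>
Both sides solve the same linear differential equation in \<open>y\<close>. Concretely, the inner product of
\<open>T y\<close> with the rotated vector has derivative 0 and equals 1 at \<open>y = x\<close>, and two unit vectors with inner
product 1 coincide.
\<close>

lemma velocity_rotates:
  obtains \<epsilon> :: real where "\<epsilon> = 1 \<or> \<epsilon> = -1"
    "\<And>x y. T y = cos (\<alpha> y - \<alpha> x) *\<^sub>R T x + (\<epsilon> * sin (\<alpha> y - \<alpha> x)) *\<^sub>R perp (T x)"
proof -
  obtain \<epsilon> :: real where \<epsilon>: "\<epsilon> = 1 \<or> \<epsilon> = -1"
    and A: "\<And>s. A s = (\<epsilon> * \<kappa> s) *\<^sub>R perp (T s)"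
    using frenet by blast
  have "T y = cos (\<alpha> y - \<alpha> x) *\<^sub>R T x + (\<epsilon> * sin (\<alpha> y - \<alpha> x)) *\<^sub>R perp (T x)" for x y
  proof -
    define w where "w y = cos (\<alpha> y - \<alpha> x) *\<^sub>R T x + (\<epsilon> * sin (\<alpha> y - \<alpha> x)) *\<^sub>R perp (T x)" for y
    have inner: "T y \<bullet> w y = cos (\<alpha> y - \<alpha> x) * (T y \<bullet> T x)
        + \<epsilon> * sin (\<alpha> y - \<alpha> x) * (T y \<bullet> perp (T x))" for y
      by (simp add: w_def inner_add_right)
    have "((\<lambda>y. T y \<bullet> w y) has_real_derivative 0) (at y)" for y
      unfolding inner
      apply (rule derivative_eq_intros DERIV_inner_velocity DERIV_angle refl)+
      using \<epsilon> by (elim disjE) (simp_all add: A perp_antisym)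
    then have "T y \<bullet> w y = T x \<bullet> w x"
      by (rule DERIV_isconst_all [rule_format])
    also have "\<dots> = 1"
      using unit_speed by (simp add: w_def norm_eq_1)
    finally have "T y \<bullet> w y = 1" .
    moreover have "T y \<bullet> T y = 1" "T x \<bullet> T x = 1" "\<epsilon> * \<epsilon> = 1"
      using unit_speed \<epsilon> by (auto simp: norm_eq_1)
    moreover have "w y \<bullet> w y = 1"
      using \<open>T x \<bullet> T x = 1\<close> \<epsilon> sin_cos_squared_add [of "\<alpha> y - \<alpha> x"]
      by (auto simp: w_def inner_add_left inner_add_right power2_eq_square algebra_simps)
    ultimately have "(T y - w y) \<bullet> (T y - w y) = 0"
      by (simp add: inner_diff_left inner_diff_right inner_commute)
    then show ?thesis by (simp add: w_def)
  qed
  with \<epsilon> that show ?thesis by blast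
qed

lemma velocity_inner: "T y \<bullet> T x = cos (\<alpha> y - \<alpha> x)"
proof -
  obtain \<epsilon> :: real
    where "T y = cos (\<alpha> y - \<alpha> x) *\<^sub>R T x + (\<epsilon> * sin (\<alpha> y - \<alpha> x)) *\<^sub>R perp (T x)"
    using velocity_rotates by metis
  moreover have "T x \<bullet> T x = 1"
    using unit_speed by (simp add: norm_eq_1)
  ultimately show ?thesis by (simp add: inner_add_left)
qed

lemma chord_le_arc:
  assumes "a \<le> b"
  shows "norm (\<xi> b - \<xi> a) \<le> b - a"
proof (cases "a = b")
  case False
  define v where "v = \<xi> b - \<xi> a"
  obtain z where z: "\<xi> b \<bullet> v - \<xi> a \<bullet> v = (b - a) * (T z \<bullet> v)"
    using MVT2 [of a b "\<lambda>s. \<xi> s \<bullet> v"] DERIV_inner_position assms False by force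
  have "(norm v)\<^sup>2 = (b - a) * (T z \<bullet> v)"
    using z by (simp add: v_def power2_norm_eq_inner inner_diff_left)
  also have "\<dots> \<le> (b - a) * norm v"
    using norm_cauchy_schwarz [of "T z" v] assms by (intro mult_left_mono) (auto simp: unit_speed)
  finally show ?thesis
    by (cases "v = 0") (use assms in \<open>auto simp: v_def power2_eq_square\<close>)
qed simp

text \<open>
The chord is at least its projection to the tangent direction at the midpoint of the arc. The
velocity makes an angle of at most \<open>K \<bar>s - m\<bar>\<close> with that direction, and \<open>cos u \<ge> 1 - u\<^sup>2 / 2\<close>. Projecting
to the tangent at the midpoint, and not at an end, produces the sharp constant 24.
\<close>

lemma chord_lower_bound:
  assumes "a \<le> b" and K: "\<And>s. s \<in> {a..b} \<Longrightarrow> \<kappa> s \<le> K"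
  shows "b - a - K\<^sup>2 * (b - a) ^ 3 / 24 \<le> norm (\<xi> b - \<xi> a)"
proof -
  define m where "m = (a + b) / 2"
  have m: "m \<in> {a..b}" using assms(1) by (auto simp: m_def)
  have K0: "K > 0" using K [OF m] curvature_pos [of m] by linarith
  have angle: "\<bar>\<alpha> s - \<alpha> m\<bar> \<le> K * \<bar>s - m\<bar>" if "s \<in> {a..b}" for s
  proof -
    have "norm (\<alpha> s - \<alpha> m) \<le> K * norm (s - m)"
    proof (rule field_differentiable_bound [of "{a..b}" \<alpha> \<kappa>])
      show "(\<alpha> has_field_derivative \<kappa> z) (at z within {a..b})" for z
        by (rule has_field_derivative_at_within) (rule DERIV_angle)
      show "norm (\<kappa> z) \<le> K" if "z \<in> {a..b}" for z
        using K [OF that] curvature_pos [of z] by simp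
    qed (use m that in auto)
    then show ?thesis by simp
  qed
  \<comment> \<open>The last term of \<open>f\<close> compensates the loss of the projection, which makes \<open>f\<close> nondecreasing.\<close>
  define f where "f s = \<xi> s \<bullet> T m - s + K\<^sup>2 * (s - m) ^ 3 / 6" for s
  have "f a \<le> f b"
  proof (rule DERIV_nonneg_imp_nondecreasing [OF \<open>a \<le> b\<close>])
    fix s assume s: "a \<le> s" "s \<le> b"
    have deriv: "(f has_real_derivative T s \<bullet> T m - 1 + K\<^sup>2 * (s - m)\<^sup>2 / 2) (at s)"
      unfolding f_def by (auto intro!: derivative_eq_intros DERIV_inner_position)
    have "(\<alpha> s - \<alpha> m)\<^sup>2 \<le> (K * \<bar>s - m\<bar>)\<^sup>2"
      using angle [of s] s by (intro abs_le_square_iff [THEN iffD1]) (use K0 in auto)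
    then have "1 - K\<^sup>2 * (s - m)\<^sup>2 / 2 \<le> 1 - (\<alpha> s - \<alpha> m)\<^sup>2 / 2"
      by (simp add: power_mult_distrib)
    also have "\<dots> \<le> cos (\<alpha> s - \<alpha> m)"
    proof -
      have "(sin ((\<alpha> s - \<alpha> m) / 2))\<^sup>2 \<le> ((\<alpha> s - \<alpha> m) / 2)\<^sup>2"
        using abs_sin_x_le_abs_x by (intro abs_le_square_iff [THEN iffD1])
      moreover have "cos (\<alpha> s - \<alpha> m) = 1 - 2 * (sin ((\<alpha> s - \<alpha> m) / 2))\<^sup>2"
        by (subst cos_double_sin [symmetric]) (simp only: times_divide_eq_right nonzero_mult_div_cancel_left)
      ultimately show ?thesis by (simp add: power_divide)
    qed
    also have "\<dots> = T s \<bullet> T m" by (simp add: velocity_inner)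
    finally show "\<exists>y. (f has_real_derivative y) (at s) \<and> 0 \<le> y"
      using deriv by (intro exI conjI) auto
  qed
  moreover have "(a - m) ^ 3 = - ((b - a) ^ 3) / 8" "(b - m) ^ 3 = (b - a) ^ 3 / 8"
    by (simp_all add: m_def power3_eq_cube field_simps)
  ultimately have "b - a - K\<^sup>2 * (b - a) ^ 3 / 24 \<le> (\<xi> b - \<xi> a) \<bullet> T m"
    by (simp add: f_def inner_diff_left algebra_simps)
  also have "\<dots> \<le> norm (\<xi> b - \<xi> a)"
    using norm_cauchy_schwarz [of "\<xi> b - \<xi> a" "T m"] by (simp add: unit_speed)
  finally show ?thesis .
qed

end

section \<open>Total curvature of a strictly convex table\<close>

locale convex_table = regular_closed_curve +
  fixes \<Omega> :: "(real^2) set"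
  assumes open_table: "open \<Omega>" and bounded_table: "bounded \<Omega>" and nonempty_table: "\<Omega> \<noteq> {}"
    and strictly_convex_table: "strictly_convex \<Omega>"
    and simple: "inj_on \<xi> {0..<1}"
    and frontier_table: "\<xi> ` {0..<1} = frontier \<Omega>"
begin

lemma position_frontier: "\<xi> s \<in> frontier \<Omega>"
proof -
  have "\<xi> (s + of_int (- \<lfloor>s\<rfloor>)) = \<xi> s"
    by (rule periodic_add_of_int) (rule periodic)
  moreover have "s + of_int (- \<lfloor>s\<rfloor>) \<in> {0..<1}"
    by simp linarith
  ultimately show ?thesis
    using frontier_table by (metis imageI)
qed

lemma convex: "convex \<Omega>"
  unfolding convex_contains_open_segment
proof (intro ballI)
  fix a b assume "a \<in> \<Omega>" "b \<in> \<Omega>"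
  then have "a \<in> closure \<Omega>" "b \<in> closure \<Omega>" using closure_subset by auto
  then show "open_segment a b \<subseteq> \<Omega>"
    using strictly_convex_table interior_subset [of \<Omega>] unfolding strictly_convex_def
    by (cases "a = b") auto
qed

text \<open>
At a boundary point whose tangent is orthogonal to \<open>u\<close>, the linear function \<open>u\<close> attains its minimum or
its maximum over the table, and nowhere else. A supporting line at the point must be the tangent line,
so \<open>u\<close> is a multiple of the normal of that line; strict convexity makes the contact point unique.
\<close>

lemma unique_support:
  assumes u: "u \<noteq> 0" "T s \<bullet> u = 0"
  shows "(\<forall>y \<in> closure \<Omega> - {\<xi> s}. \<xi> s \<bullet> u < y \<bullet> u) \<or> (\<forall>y \<in> closure \<Omega> - {\<xi> s}. y \<bullet> u < \<xi> s \<bullet> u)"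
proof -
  have rel: "rel_interior (closure \<Omega>) = \<Omega>"
    by (simp add: convex_rel_interior_closure convex open_table rel_interior_open)
  have xi: "\<xi> s \<in> closure \<Omega>" "\<xi> s \<notin> \<Omega>"
    using position_frontier [of s] open_table by (auto simp: frontier_def interior_open)
  have "\<exists>a. a \<noteq> 0 \<and> (\<forall>y\<in>closure \<Omega>. a \<bullet> \<xi> s \<le> a \<bullet> y) \<and> (\<forall>y\<in>\<Omega>. a \<bullet> \<xi> s < a \<bullet> y)"
  proof (rule supporting_hyperplane_rel_boundary
      [OF convex_closure [OF convex] xi(1), unfolded rel, OF xi(2)])
    fix a
    assume "a \<noteq> 0" "\<And>y. y \<in> closure \<Omega> \<Longrightarrow> a \<bullet> \<xi> s \<le> a \<bullet> y" "\<And>y. y \<in> \<Omega> \<Longrightarrow> a \<bullet> \<xi> s < a \<bullet> y"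
    then show ?thesis by (intro exI [where x = a] conjI ballI)
  qed
  then obtain a where a: "a \<noteq> 0" and le: "\<forall>y\<in>closure \<Omega>. a \<bullet> \<xi> s \<le> a \<bullet> y"
    and less: "\<forall>y\<in>\<Omega>. a \<bullet> \<xi> s < a \<bullet> y"
    by (elim exE conjE)
  have strict: "\<xi> s \<bullet> a < y \<bullet> a" if y: "y \<in> closure \<Omega> - {\<xi> s}" for y
  proof -
    have "y \<noteq> \<xi> s" "y \<in> closure \<Omega>" using y by auto
    then have "midpoint (\<xi> s) y \<in> open_segment (\<xi> s) y"
      by simp
    also have "\<dots> \<subseteq> interior \<Omega>"
      using strictly_convex_table [unfolded strictly_convex_def, rule_format, OF xi(1), of y]
        \<open>y \<noteq> \<xi> s\<close> \<open>y \<in> closure \<Omega>\<close> by simp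
    also have "\<dots> \<subseteq> \<Omega>"
      by (rule interior_subset)
    finally have "midpoint (\<xi> s) y \<in> \<Omega>" .
    then have "a \<bullet> \<xi> s < a \<bullet> midpoint (\<xi> s) y" using less by (rule bspec [rotated])
    then have "a \<bullet> \<xi> s < a \<bullet> y" by (simp add: midpoint_def inner_add_right)
    then show ?thesis by (simp add: inner_commute)
  qed
  \<comment> \<open>The boundary curve lies on one side of the supporting line and touches it at \<open>s\<close>.\<close>
  have "T s \<bullet> a = 0"
  proof (rule DERIV_local_min [OF DERIV_inner_position zero_less_one])
    have "\<xi> y \<in> closure \<Omega>" for y
      using position_frontier [of y] by (simp add: frontier_def)
    then show "\<forall>y. \<bar>s - y\<bar> < 1 \<longrightarrow> \<xi> s \<bullet> a \<le> \<xi> y \<bullet> a"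
      using le by (simp only: inner_commute [of _ a]) blast
  qed
  define N where "N = perp (T s)"
  have a_N: "(a \<bullet> N) *\<^sub>R N = a" and u_N: "(u \<bullet> N) *\<^sub>R N = u"
    using orthonormal_expansion [OF unit_speed, of a s, symmetric]
      orthonormal_expansion [OF unit_speed, of u s, symmetric] u(2) \<open>T s \<bullet> a = 0\<close>
    by (simp_all add: N_def inner_commute)
  define c where "c = (u \<bullet> N) / (a \<bullet> N)"
  have "a \<bullet> N \<noteq> 0" using a_N a by (metis scale_zero_left)
  moreover have "u \<bullet> N \<noteq> 0" using u_N u(1) by (metis scale_zero_left)
  ultimately have "c \<noteq> 0" by (simp add: c_def)
  have "c *\<^sub>R ((a \<bullet> N) *\<^sub>R N) = (u \<bullet> N) *\<^sub>R N"
    using \<open>a \<bullet> N \<noteq> 0\<close> by (simp add: c_def)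
  then have "u = c *\<^sub>R a"
    by (simp only: a_N u_N)
  then have scaled: "y \<bullet> u = c * (y \<bullet> a)" for y by (simp only: inner_scaleR_right)
  show ?thesis
  proof (cases "c > 0")
    case True
    then show ?thesis
      unfolding scaled using strict mult_strict_left_mono by blast
  next
    case False
    with \<open>c \<noteq> 0\<close> have "c < 0" by simp
    then show ?thesis
      unfolding scaled using strict mult_strict_left_mono_neg by blast
  qed
qed

text \<open>
The tangent closes up, so the total angle is a positive multiple of \<open>2 \<pi>\<close>. If it exceeded \<open>2 \<pi>\<close>, the
tangent would be parallel to its initial direction at three parameters of one period, with angles
\<open>0\<close>, \<open>\<pi>\<close> and \<open>2 \<pi>\<close>. Each of these points is the unique minimum or the unique maximum of the same
linear function, so two of them coincide, against injectivity of the parametrization.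
\<close>

lemma total_curvature: "\<alpha> 1 = 2 * pi"
proof -
  have "T 1 = T 0" using periodic_velocity [of 0] by simp
  then have "cos (\<alpha> 1) = 1"
    using velocity_inner [of 1 0] unit_speed [of 0] by (simp add: angle_zero norm_eq_1)
  then obtain n :: int where n: "\<alpha> 1 = of_int n * 2 * pi"
    using cos_one_2pi_int by auto
  have "\<alpha> 1 > 0" using angle_strict_mono [of 0 1] by (simp add: angle_zero)
  then have "n > 0" using n by (simp add: zero_less_mult_iff)
  moreover have "\<not> n > 1"
  proof
    assume "n > 1"
    then have big: "\<alpha> 1 > 2 * pi" using n by simp
    have cont: "\<forall>s. 0 \<le> s \<and> s \<le> 1 \<longrightarrow> isCont \<alpha> s"
      using DERIV_isCont [OF DERIV_angle] by blast
    obtain s1 where s1: "0 \<le> s1" "s1 \<le> 1" "\<alpha> s1 = pi"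
      using IVT [of \<alpha> 0 pi 1, OF _ _ _ cont] big pi_gt_zero by (auto simp: angle_zero)
    obtain s2 where s2: "0 \<le> s2" "s2 \<le> 1" "\<alpha> s2 = 2 * pi"
      using IVT [of \<alpha> 0 "2 * pi" 1, OF _ _ _ cont] big pi_gt_zero by (auto simp: angle_zero)
    have ne: "s1 \<noteq> 0" "s2 \<noteq> 0" "s1 \<noteq> s2" "s1 < 1" "s2 < 1"
      using s1 s2 big pi_gt_zero angle_zero by (fastforce simp: order.order_iff_strict)+
    define u where "u = perp (T 0)"
    define lowest where "lowest s \<longleftrightarrow> (\<forall>y \<in> closure \<Omega> - {\<xi> s}. \<xi> s \<bullet> u < y \<bullet> u)" for s
    define highest where "highest s \<longleftrightarrow> (\<forall>y \<in> closure \<Omega> - {\<xi> s}. y \<bullet> u < \<xi> s \<bullet> u)" for s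
    have u: "u \<noteq> 0" using unit_speed [of 0] by (metis u_def norm_perp norm_zero zero_neq_one)
    obtain \<epsilon> :: real
      where rot: "\<And>y. T y = cos (\<alpha> y - \<alpha> 0) *\<^sub>R T 0 + (\<epsilon> * sin (\<alpha> y - \<alpha> 0)) *\<^sub>R u"
      using velocity_rotates unfolding u_def by metis
    have crit: "T s \<bullet> u = 0" if "sin (\<alpha> s) = 0" for s
      using that by (subst rot) (simp add: angle_zero inner_add_left u_def)
    have "\<xi> 0 \<noteq> \<xi> s1" "\<xi> 0 \<noteq> \<xi> s2" "\<xi> s1 \<noteq> \<xi> s2"
      using ne s1 s2 inj_onD [OF simple] by auto
    moreover have "\<xi> 0 \<in> closure \<Omega>" "\<xi> s1 \<in> closure \<Omega>" "\<xi> s2 \<in> closure \<Omega>"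
      using position_frontier by (auto simp: frontier_def)
    moreover have "lowest s \<or> highest s" if "s \<in> {0, s1, s2}" for s
      unfolding lowest_def highest_def
      using that s1 s2 by (intro unique_support [OF u crit]) (auto simp: angle_zero)
    then have "lowest 0 \<or> highest 0" "lowest s1 \<or> highest s1" "lowest s2 \<or> highest s2"
      by blast+
    moreover have "\<xi> s = \<xi> t"
      if "lowest s \<and> lowest t \<or> highest s \<and> highest t" "\<xi> s \<in> closure \<Omega>" "\<xi> t \<in> closure \<Omega>" for s t
    proof (rule ccontr)
      assume "\<xi> s \<noteq> \<xi> t"
      then show False using that unfolding lowest_def highest_def by (metis DiffI less_asym singletonD)
    qed
    ultimately show False by blast
  qed
  ultimately have "n = 1" by simp
  with n show ?thesis by simp
qed

end

section \<open>Polygons whose vertices follow an optimized density\<close>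

text \<open>
This is the cube of the inequality between the geometric and the arithmetic mean of \<open>k\<close>, \<open>k\<close> and \<open>1\<close>.
\<close>

lemma cubic_amgm:
  fixes k :: real
  assumes "k > 0"
  shows "27 * k\<^sup>2 \<le> (2 * k + 1) ^ 3" "k \<noteq> 1 \<Longrightarrow> 27 * k\<^sup>2 < (2 * k + 1) ^ 3"
proof -
  \<comment> \<open>The difference has a double zero at the point of equality \<open>k = 1\<close>.\<close>
  have eq: "(2 * k + 1) ^ 3 - 27 * k\<^sup>2 = (k - 1)\<^sup>2 * (8 * k + 1)"
    by algebra
  have "(k - 1)\<^sup>2 * (8 * k + 1) \<ge> 0"
    using assms by (intro mult_nonneg_nonneg) auto
  with eq show "27 * k\<^sup>2 \<le> (2 * k + 1) ^ 3" by linarith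
  assume "k \<noteq> 1"
  then have "(k - 1)\<^sup>2 * (8 * k + 1) > 0"
    using assms by (intro mult_pos_pos) auto
  with eq show "27 * k\<^sup>2 < (2 * k + 1) ^ 3" by linarith
qed

context convex_table
begin

text \<open>
The vertices are distributed with density \<open>(2 k + 1) / 3\<close> for \<open>k = \<kappa> / (2 \<pi>)\<close>. The asymptotically
optimal density is proportional to \<open>\<kappa>\<^bsup>2/3\<^esup>\<close>; the affine function of \<open>\<kappa>\<close> used here touches the power
\<open>k\<^bsup>2/3\<^esup>\<close> from above at \<open>k = 1\<close> and has an explicit primitive, the phase.
\<close>

definition \<rho> :: "real \<Rightarrow> real" where "\<rho> s = (\<kappa> s / pi + 1) / 3"

definition phase :: "real \<Rightarrow> real" where "phase s = (\<alpha> s / pi + s) / 3"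

lemma DERIV_phase: "(phase has_real_derivative \<rho> s) (at s)"
  unfolding phase_def \<rho>_def by (auto intro!: derivative_eq_intros DERIV_angle)

lemma density_gt: "\<rho> s > 1 / 3"
  using curvature_pos [of s] by (simp add: \<rho>_def)

lemma density_pos: "\<rho> s > 0"
  using density_gt [of s] by simp

lemma phase_shift: "phase (s + 1) = phase s + 1"
  unfolding phase_def angle_shift total_curvature by (simp add: add_divide_distrib)

lemma phase_strict_mono: "x < y \<Longrightarrow> phase x < phase y"
  using DERIV_pos_imp_increasing [of x y phase] DERIV_phase density_pos by blast

lemma phase_less_iff: "phase x < phase y \<longleftrightarrow> x < y"
  using phase_strict_mono [of x y] phase_strict_mono [of y x] by (cases x y rule: linorder_cases) auto

lemma phase_le_iff: "phase x \<le> phase y \<longleftrightarrow> x \<le> y"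
  using phase_less_iff [of y x] by (simp add: not_less [symmetric])

text \<open>
For a polygon with \<open>q\<close> vertices of density \<open>\<rho>\<close>, the arc starting at \<open>s\<close> exceeds its chord by
\<open>defect s / (24 q\<^sup>3)\<close> to leading order.
\<close>

definition defect :: "real \<Rightarrow> real" where "defect s = (\<kappa> s)\<^sup>2 / (\<rho> s) ^ 3"

lemma defect_le: "defect s \<le> 4 * pi\<^sup>2"
  and defect_less: "\<kappa> s \<noteq> 2 * pi \<Longrightarrow> defect s < 4 * pi\<^sup>2"
proof -
  define k where "k = \<kappa> s / (2 * pi)"
  have k: "k > 0" "\<kappa> s = 2 * pi * k" using curvature_pos [of s] by (simp_all add: k_def)
  have \<rho>: "\<rho> s = (2 * k + 1) / 3" by (simp add: \<rho>_def k_def)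
  have eq: "defect s = 4 * pi\<^sup>2 * (27 * k\<^sup>2 / (2 * k + 1) ^ 3)"
    unfolding defect_def \<rho> k(2) by (simp add: power_divide power_mult_distrib)
  have "27 * k\<^sup>2 / (2 * k + 1) ^ 3 \<le> 1"
    using cubic_amgm(1) [OF k(1)] k(1) by simp
  then have "4 * pi\<^sup>2 * (27 * k\<^sup>2 / (2 * k + 1) ^ 3) \<le> 4 * pi\<^sup>2 * 1"
    by (rule mult_left_mono) simp
  then show "defect s \<le> 4 * pi\<^sup>2"
    unfolding eq by simp
  assume "\<kappa> s \<noteq> 2 * pi"
  then have "27 * k\<^sup>2 / (2 * k + 1) ^ 3 < 1"
    using cubic_amgm(2) [OF k(1)] k by auto
  then have "4 * pi\<^sup>2 * (27 * k\<^sup>2 / (2 * k + 1) ^ 3) < 4 * pi\<^sup>2 * 1"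
    by (rule mult_strict_left_mono) simp
  then show "defect s < 4 * pi\<^sup>2"
    unfolding eq by simp
qed

lemma continuous_density: "continuous_on S \<rho>"
  unfolding \<rho>_def by (intro continuous_intros continuous_curvature) auto

lemma continuous_defect: "continuous_on S defect"
  unfolding defect_def
  by (intro continuous_intros continuous_curvature continuous_density)
    (metis density_pos less_irrefl power_not_zero)

text \<open>
Here the leading order statement about the defect becomes a uniform estimate. By the mean value
theorem the arc has length \<open>1 / (q \<rho>(\<zeta>))\<close> for some \<open>\<zeta>\<close> on it, and the curvature on it has a maximum
at some \<open>\<sigma>\<close>. Both parameters are close to \<open>a\<close>, and \<open>(\<kappa> \<sigma>)\<^sup>2 / (\<rho> \<zeta>)\<^sup>3\<close> is a uniformly continuous function of
the pair \<open>(\<sigma>, \<zeta>)\<close> over one period.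
\<close>

lemma phase_step_chord:
  assumes "\<epsilon> > 0"
  obtains Q where "\<And>q a b. \<lbrakk>Q \<le> q; 0 < q; x\<^sub>0 \<le> a; b \<le> x\<^sub>0 + 1; phase b = phase a + 1 / real q\<rbrakk>
    \<Longrightarrow> b - a - (defect a + \<epsilon>) / (24 * real q ^ 3) \<le> norm (\<xi> b - \<xi> a)"
proof -
  define S where "S = {x\<^sub>0..x\<^sub>0 + 1} \<times> {x\<^sub>0..x\<^sub>0 + 1}"
  define \<Phi> where "\<Phi> p = (\<kappa> (fst p))\<^sup>2 / (\<rho> (snd p)) ^ 3" for p
  have "continuous_on S \<Phi>"
    unfolding \<Phi>_def
    by (intro continuous_intros continuous_on_compose2 [OF continuous_curvature [of UNIV]]
        continuous_on_compose2 [OF continuous_density [of UNIV]])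
      (auto simp: density_pos [THEN less_imp_neq, symmetric])
  moreover have "compact S" by (simp add: S_def compact_Times)
  ultimately have "uniformly_continuous_on S \<Phi>"
    by (rule compact_uniformly_continuous)
  then obtain \<delta> where \<delta>: "\<delta> > 0"
    and unif: "\<And>p p'. \<lbrakk>p \<in> S; p' \<in> S; dist p' p < \<delta>\<rbrakk> \<Longrightarrow> dist (\<Phi> p') (\<Phi> p) < \<epsilon>"
    using assms unfolding uniformly_continuous_on_def by metis
  \<comment> \<open>As \<open>\<rho> > 1/3\<close>, an arc is shorter than \<open>3 / q\<close>, and the two parameters together
    deviate from \<open>a\<close> by less than \<open>6 / q\<close>.\<close>
  define Q where "Q = nat \<lceil>6 / \<delta>\<rceil> + 1"
  have "b - a - (defect a + \<epsilon>) / (24 * real q ^ 3) \<le> norm (\<xi> b - \<xi> a)"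
    if q: "Q \<le> q" "0 < q" and ab: "x\<^sub>0 \<le> a" "b \<le> x\<^sub>0 + 1" "phase b = phase a + 1 / real q" for q a b
  proof -
    have "a < b" using ab(3) q phase_less_iff [of a b] by simp
    then obtain \<zeta> where \<zeta>: "a < \<zeta>" "\<zeta> < b" "phase b - phase a = (b - a) * \<rho> \<zeta>"
      using MVT2 [of a b phase \<rho>] DERIV_phase by blast
    have "(b - a) * \<rho> \<zeta> = 1 / real q"
      using \<zeta>(3) ab(3) by simp
    then have "b - a = 1 / real q / \<rho> \<zeta>"
      by (rule eq_divide_imp [rotated]) (use density_pos [of \<zeta>] in simp)
    then have len: "b - a = 1 / (real q * \<rho> \<zeta>)"
      by simp
    have "b - a \<le> 3 / real q"
      unfolding len using density_gt [of \<zeta>] q by (simp add: field_simps)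
    moreover have "6 / \<delta> < real q"
      using q(1) unfolding Q_def by linarith
    then have "6 / real q < \<delta>"
      using \<delta> q by (simp add: field_simps)
    ultimately have short: "2 * (b - a) < \<delta>"
      by simp
    obtain \<sigma> where \<sigma>: "\<sigma> \<in> {a..b}" "\<And>s. s \<in> {a..b} \<Longrightarrow> \<kappa> s \<le> \<kappa> \<sigma>"
      using continuous_attains_sup [of "{a..b}" \<kappa>] continuous_curvature \<open>a < b\<close> by auto
    have "dist (\<sigma>, \<zeta>) (a, a) \<le> dist \<sigma> a + dist \<zeta> a"
      unfolding dist_Pair_Pair by (rule sqrt_sum_squares_le_sum) auto
    also have "\<dots> < \<delta>"
      using \<sigma>(1) \<zeta> short by (simp add: dist_real_def)
    finally have "dist (\<Phi> (\<sigma>, \<zeta>)) (\<Phi> (a, a)) < \<epsilon>"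
      using \<sigma>(1) \<zeta> ab \<open>a < b\<close> by (intro unif) (auto simp: S_def)
    then have \<Phi>: "\<Phi> (\<sigma>, \<zeta>) \<le> defect a + \<epsilon>"
      by (auto simp: \<Phi>_def defect_def dist_real_def)
    have "(\<kappa> \<sigma>)\<^sup>2 * (b - a) ^ 3 = \<Phi> (\<sigma>, \<zeta>) / real q ^ 3"
      unfolding len \<Phi>_def by (simp add: power_divide power_mult_distrib)
    also have "\<dots> \<le> (defect a + \<epsilon>) / real q ^ 3"
      using \<Phi> by (intro divide_right_mono) auto
    finally have "(\<kappa> \<sigma>)\<^sup>2 * (b - a) ^ 3 / 24 \<le> (defect a + \<epsilon>) / real q ^ 3 / 24"
      by (rule divide_right_mono) simp
    also have "\<dots> = (defect a + \<epsilon>) / (24 * real q ^ 3)"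
      by simp
    finally have "(\<kappa> \<sigma>)\<^sup>2 * (b - a) ^ 3 / 24 \<le> (defect a + \<epsilon>) / (24 * real q ^ 3)" .
    moreover have "b - a - (\<kappa> \<sigma>)\<^sup>2 * (b - a) ^ 3 / 24 \<le> norm (\<xi> b - \<xi> a)"
      using \<open>a < b\<close> \<sigma>(2) by (intro chord_lower_bound) auto
    ultimately show ?thesis by linarith
  qed
  then show thesis by (rule that)
qed

lemma phase_sequence:
  assumes "q > 0"
  obtains x where "x \<in> pq_sequences 1 q"
    "\<And>i. i \<le> q \<Longrightarrow> x\<^sub>0 \<le> x i \<and> x i \<le> x\<^sub>0 + 1 \<and> phase (x i) = phase x\<^sub>0 + real i / real q"
proof -
  have "\<exists>t. i \<le> q \<longrightarrow> x\<^sub>0 \<le> t \<and> t \<le> x\<^sub>0 + 1 \<and> phase t = phase x\<^sub>0 + real i / real q" for i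
  proof (cases "i \<le> q")
    case True
    then have "real i / real q \<le> 1" using assms by simp
    then have "\<exists>t. x\<^sub>0 \<le> t \<and> t \<le> x\<^sub>0 + 1 \<and> phase t = phase x\<^sub>0 + real i / real q"
      using DERIV_isCont [OF DERIV_phase] by (intro IVT) (auto simp: phase_shift)
    then show ?thesis by blast
  qed simp
  then obtain x where x: "\<And>i. i \<le> q \<longrightarrow> x\<^sub>0 \<le> x i \<and> x i \<le> x\<^sub>0 + 1 \<and> phase (x i) = phase x\<^sub>0 + real i / real q"
    by metis
  have "x q = x 0 + 1"
  proof -
    have "phase (x q) = phase (x 0 + 1)"
      using x [of q] x [of 0] assms by (simp add: phase_shift)
    then show ?thesis using phase_le_iff by (metis order.antisym order.refl)
  qed
  moreover have "x i \<le> x (Suc i) \<and> x (Suc i) \<le> x i + 1" if "i < q" for i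
  proof -
    have "phase (x i) \<le> phase (x (Suc i))" "phase (x (Suc i)) \<le> phase (x i + 1)"
      using x [of i] x [of "Suc i"] that assms
      by (auto simp: phase_shift add_divide_distrib)
    then show ?thesis by (simp add: phase_le_iff)
  qed
  ultimately have "x \<in> pq_sequences 1 q"
    by (simp add: pq_sequences_def)
  then show thesis using x by (intro that [of x]) auto
qed

text \<open>
Chords are no longer than their arcs, and the arcs add up to the perimeter.
\<close>

lemma minimal_action_ge_perimeter:
  assumes "q > 0"
  shows "- 1 \<le> minimal_action \<xi> 1 q"
proof -
  obtain x where x: "x \<in> pq_sequences 1 q" "action \<xi> q x = minimal_action \<xi> 1 q"
    using minimal_action_attained [OF continuous_position periodic, of 1 q] assms by auto
  have "- 1 = (\<Sum>i<q. - (x (Suc i) - x i))"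
    using x(1) by (simp only: sum_negf sum_lessThan_telescope) (simp add: pq_sequences_def)
  also have "\<dots> \<le> action \<xi> q x"
    unfolding action_def billiard_h_def
  proof (rule sum_mono)
    fix i assume "i \<in> {..<q}"
    then have "x i \<le> x (Suc i)" using x(1) by (auto simp: pq_sequences_def)
    then show "- (x (Suc i) - x i) \<le> - norm (\<xi> (x i) - \<xi> (x (Suc i)))"
      using chord_le_arc [of "x i" "x (Suc i)"] by (simp add: norm_minus_commute)
  qed
  finally show ?thesis using x(2) by simp
qed

text \<open>
The estimate for a polygon with \<open>m N\<close> vertices at equidistant phases, starting at \<open>x\<^sub>0\<close>. Its first
\<open>m\<close> arcs start in the initial \<open>N\<close>-th part of the period, where the defect is bounded by \<open>B\<close>; for all
others the general bound \<open>4 \<pi>\<^sup>2\<close> is used. Restricting to multiples of \<open>N\<close> makes this proportion exact.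
\<close>

lemma minimal_action_upper_bound:
  assumes "\<epsilon> > 0" "N > 0"
    and B: "\<And>s. \<lbrakk>x\<^sub>0 \<le> s; phase s \<le> phase x\<^sub>0 + 1 / real N\<rbrakk> \<Longrightarrow> defect s \<le> B"
  obtains Q where "\<And>m. \<lbrakk>Q \<le> m; 0 < m\<rbrakk> \<Longrightarrow>
    (real (m * N))\<^sup>2 * (minimal_action \<xi> 1 (m * N) + 1) \<le> (4 * pi\<^sup>2 + (B - 4 * pi\<^sup>2) / real N + \<epsilon>) / 24"
proof -
  obtain Q where Q: "\<And>q a b. \<lbrakk>Q \<le> q; 0 < q; x\<^sub>0 \<le> a; b \<le> x\<^sub>0 + 1; phase b = phase a + 1 / real q\<rbrakk>
    \<Longrightarrow> b - a - (defect a + \<epsilon>) / (24 * real q ^ 3) \<le> norm (\<xi> b - \<xi> a)"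
    using phase_step_chord [OF assms(1)] by metis
  have "(real (m * N))\<^sup>2 * (minimal_action \<xi> 1 (m * N) + 1) \<le> (4 * pi\<^sup>2 + (B - 4 * pi\<^sup>2) / real N + \<epsilon>) / 24"
    if m: "Q \<le> m" "0 < m" for m
  proof -
    define q where "q = m * N"
    have q: "Q \<le> q" "0 < q" "m \<le> q" using m \<open>N > 0\<close> by (auto simp: q_def intro: order.trans)
    obtain x where seq: "x \<in> pq_sequences 1 q"
      and x: "\<And>i. i \<le> q \<Longrightarrow> x\<^sub>0 \<le> x i \<and> x i \<le> x\<^sub>0 + 1 \<and> phase (x i) = phase x\<^sub>0 + real i / real q"
      using phase_sequence [OF q(2)] by metis
    have "minimal_action \<xi> 1 q \<le> action \<xi> q x"
      using minimal_action_attained [OF continuous_position periodic, of 1 q] q(2) seq by auto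
    also have "\<dots> \<le> (\<Sum>i<q. (defect (x i) + \<epsilon>) / (24 * real q ^ 3) - (x (Suc i) - x i))"
      unfolding action_def billiard_h_def
    proof (rule sum_mono)
      fix i assume "i \<in> {..<q}"
      then have "x (Suc i) - x i - (defect (x i) + \<epsilon>) / (24 * real q ^ 3) \<le> norm (\<xi> (x (Suc i)) - \<xi> (x i))"
        using x [of i] x [of "Suc i"] q by (intro Q) (auto simp: add_divide_distrib)
      then show "- norm (\<xi> (x i) - \<xi> (x (Suc i)))
          \<le> (defect (x i) + \<epsilon>) / (24 * real q ^ 3) - (x (Suc i) - x i)"
        by (simp add: norm_minus_commute)
    qed
    also have "\<dots> = (\<Sum>i<q. defect (x i) + \<epsilon>) / (24 * real q ^ 3) - 1"
    proof -
      have "(\<Sum>i<q. x (Suc i) - x i) = 1"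
        using seq by (simp only: sum_lessThan_telescope) (simp add: pq_sequences_def)
      then show ?thesis
        by (subst sum_subtractf) (simp only: sum_divide_distrib)
    qed
    finally have le: "minimal_action \<xi> 1 q + 1 \<le> (\<Sum>i<q. defect (x i) + \<epsilon>) / (24 * real q ^ 3)"
      by simp
    have "(\<Sum>i<q. defect (x i) + \<epsilon>) = (\<Sum>i<m. defect (x i)) + (\<Sum>i=m..<q. defect (x i)) + real q * \<epsilon>"
      using sum.atLeastLessThan_concat [of 0 m q "\<lambda>i. defect (x i)"] q(3)
      by (simp add: sum.distrib atLeast0LessThan)
    also have "\<dots> \<le> (\<Sum>i<m. B) + (\<Sum>i=m..<q. 4 * pi\<^sup>2) + real q * \<epsilon>"
    proof (intro add_mono sum_mono order.refl)
      fix i assume "i \<in> {..<m}"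
      then have "real i / real q \<le> 1 / real N"
        using \<open>N > 0\<close> m by (simp add: q_def field_simps)
      then show "defect (x i) \<le> B"
        using x [of i] \<open>i \<in> {..<m}\<close> q(3) by (intro B) auto
    qed (rule defect_le)
    also have "\<dots> = real q * (4 * pi\<^sup>2 + (B - 4 * pi\<^sup>2) / real N + \<epsilon>)"
      using q(3) \<open>N > 0\<close> by (simp add: of_nat_diff q_def field_simps)
    finally have "(\<Sum>i<q. defect (x i) + \<epsilon>) / (24 * real q ^ 3)
        \<le> real q * (4 * pi\<^sup>2 + (B - 4 * pi\<^sup>2) / real N + \<epsilon>) / (24 * real q ^ 3)"
      by (rule divide_right_mono) simp
    with le have "minimal_action \<xi> 1 q + 1 \<le> real q * (4 * pi\<^sup>2 + (B - 4 * pi\<^sup>2) / real N + \<epsilon>) / (24 * real q ^ 3)"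
      by linarith
    then have "(real q)\<^sup>2 * (minimal_action \<xi> 1 q + 1)
        \<le> (real q)\<^sup>2 * (real q * (4 * pi\<^sup>2 + (B - 4 * pi\<^sup>2) / real N + \<epsilon>) / (24 * real q ^ 3))"
      by (rule mult_left_mono) simp
    also have "\<dots> = (4 * pi\<^sup>2 + (B - 4 * pi\<^sup>2) / real N + \<epsilon>) / 24"
      using q(2) by (simp add: power2_eq_square power3_eq_cube)
    finally show ?thesis by (simp add: q_def)
  qed
  then show thesis by (rule that)
qed

end

section \<open>Discs\<close>

text \<open>
The open ball and the exterior of the closed ball are connected and avoid the frontier of \<open>S\<close>, so each
of them lies inside \<open>S\<close> or is disjoint from \<open>S\<close>. The exterior is unbounded, hence disjoint from \<open>S\<close>.
\<close>

lemma eq_ball_if_frontier_subset_sphere: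
  fixes c :: "'a::euclidean_space"
  assumes "open S" "bounded S" "S \<noteq> {}" and dim: "2 \<le> DIM('a)"
    and sphere: "frontier S \<subseteq> sphere c r"
  shows "S = ball c r"
proof -
  have "- cball c r \<inter> frontier S = {}"
    using sphere by auto
  moreover have "connected (- cball c r)"
    using dim by (intro connected_complement_bounded_convex) auto
  ultimately have "- cball c r \<inter> S = {} \<or> - cball c r \<subseteq> S"
    using connected_Int_frontier [of "- cball c r" S] by blast
  moreover have "\<not> - cball c r \<subseteq> S"
  proof
    assume "- cball c r \<subseteq> S"
    then have "bounded (- cball c r \<union> cball c r)"
      using assms(2) by (intro bounded_Un [THEN iffD2] conjI bounded_cball) (rule bounded_subset)
    then show False by simp
  qed
  ultimately have "S \<subseteq> interior (cball c r)"
    using \<open>open S\<close> by (intro interior_maximal) auto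
  then have sub: "S \<subseteq> ball c r"
    by simp
  have "ball c r \<inter> frontier S = {}"
    using sphere by auto
  then have "ball c r \<inter> S = {} \<or> ball c r \<subseteq> S"
    using connected_Int_frontier [of "ball c r" S] by auto
  with sub \<open>S \<noteq> {}\<close> show ?thesis by auto
qed

lemma sin_le_tangent:
  assumes "0 \<le> x" "x \<le> pi" "0 < a" "a < pi"
  shows "sin x \<le> sin a + cos a * (x - a)"
proof -
  have "convex_on {0..pi} (\<lambda>x. - sin x)"
  proof (rule f''_ge0_imp_convex)
    show "((\<lambda>x. - sin x) has_real_derivative - cos x) (at x)" for x :: real
      by (auto intro!: derivative_eq_intros)
    show "((\<lambda>x. - cos x) has_real_derivative sin x) (at x)" for x :: real
      by (auto intro!: derivative_eq_intros)
    show "0 \<le> sin x" if "x \<in> {0..pi}" for x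
      using that by (simp add: sin_ge_zero)
  qed simp
  moreover have "((\<lambda>x. - sin x) has_real_derivative - cos a) (at a within {0..pi})"
    by (auto intro!: derivative_eq_intros)
  ultimately have "- sin x - (- sin a) \<ge> - cos a * (x - a)"
    using assms by (intro convex_on_imp_above_tangent [where A = "{0..pi}"]) auto
  then show ?thesis by simp
qed

context convex_table
begin

text \<open>
The centre of curvature does not move: its derivative is \<open>T\<close> plus the radius times the derivative of the
normal, and these cancel.
\<close>

lemma circle_if_constant_curvature:
  assumes "\<And>s. \<kappa> s = 2 * pi"
  obtains c p where "\<bar>p\<bar> = 1 / (2 * pi)" "\<And>s. \<xi> s = c + p *\<^sub>R perp (T s)"
proof -
  obtain \<epsilon> :: real where \<epsilon>: "\<epsilon> = 1 \<or> \<epsilon> = - 1" and A: "\<And>s. A s = (\<epsilon> * \<kappa> s) *\<^sub>R perp (T s)"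
    using frenet by blast
  define p where "p = - \<epsilon> / (2 * pi)"
  define f where "f s = \<xi> s - p *\<^sub>R perp (T s)" for s
  have "(f has_vector_derivative 0) (at s)" for s
  proof -
    have "(f has_vector_derivative T s - p *\<^sub>R perp (A s)) (at s)"
      unfolding f_def
      by (intro has_vector_derivative_diff velocity
          bounded_linear.has_vector_derivative [OF bounded_linear_scaleR_right]
          bounded_linear.has_vector_derivative [OF bounded_linear_perp] acceleration)
    moreover have "p *\<^sub>R perp (A s) = T s"
      using \<epsilon> bounded_linear_perp [THEN bounded_linear.linear]
      by (auto simp: A assms linear_cmul p_def)
    ultimately show ?thesis by simp
  qed
  then obtain c where c: "\<And>s. f s = c"
    using has_vector_derivative_zero_constant [of UNIV f] by auto
  show thesis
  proof (rule that)
    show "\<bar>p\<bar> = 1 / (2 * pi)" using \<epsilon> by (auto simp: p_def)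
    show "\<xi> s = c + p *\<^sub>R perp (T s)" for s
      using c [of s] by (simp add: f_def algebra_simps)
  qed
qed

lemma disc_if_constant_curvature:
  assumes "\<And>s. \<kappa> s = 2 * pi"
  obtains c r where "r > 0" "\<Omega> = ball c r"
proof -
  obtain c p where p: "\<bar>p\<bar> = 1 / (2 * pi)" and \<xi>: "\<And>s. \<xi> s = c + p *\<^sub>R perp (T s)"
    using circle_if_constant_curvature assms by metis
  have "\<xi> s \<in> sphere c (1 / (2 * pi))" for s
    unfolding \<xi> by (simp add: dist_norm unit_speed p)
  then have "frontier \<Omega> \<subseteq> sphere c (1 / (2 * pi))"
    unfolding frontier_table [symmetric] by blast
  then have "\<Omega> = ball c (1 / (2 * pi))"
    using open_table bounded_table nonempty_table by (intro eq_ball_if_frontier_subset_sphere) auto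
  then show thesis by (intro that [of "1 / (2 * pi)" c]) auto
qed

text \<open>
Differentiating \<open>\<bar>\<xi> - c\<bar>\<^sup>2 = r\<^sup>2\<close> twice gives \<open>A \<bullet> (\<xi> - c) = -1\<close>, where both vectors are normal to the
curve; so the curvature is \<open>1 / r\<close>. Its value is then determined by the total curvature.
\<close>

lemma disc_imp_constant_curvature:
  assumes "\<Omega> = ball c r" "r > 0"
  shows "\<kappa> s = 2 * pi"
proof -
  have on_sphere: "norm (\<xi> s - c) = r" for s
    using position_frontier [of s] assms by (simp add: dist_norm norm_minus_commute)
  have velocity': "((\<lambda>s. \<xi> s - c) has_vector_derivative T s) (at s)" for s
    using has_vector_derivative_diff [OF velocity has_vector_derivative_const] by simp
  have tangent: "T s \<bullet> (\<xi> s - c) = 0" for s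
  proof -
    have "((\<lambda>s. (\<xi> s - c) \<bullet> (\<xi> s - c)) has_real_derivative 2 * (T s \<bullet> (\<xi> s - c))) (at s)"
      using bounded_bilinear.has_vector_derivative
        [OF bounded_bilinear_inner velocity' velocity', of s]
      by (simp add: has_real_derivative_iff_has_vector_derivative inner_commute)
    moreover have "(\<lambda>s. (\<xi> s - c) \<bullet> (\<xi> s - c)) = (\<lambda>s. r\<^sup>2)"
      using on_sphere by (simp add: power2_norm_eq_inner [symmetric])
    ultimately show ?thesis
      using DERIV_unique [OF _ DERIV_const] by fastforce
  qed
  have normal: "A s \<bullet> (\<xi> s - c) = - 1" for s
  proof -
    have "((\<lambda>s. T s \<bullet> (\<xi> s - c)) has_real_derivative A s \<bullet> (\<xi> s - c) + T s \<bullet> T s) (at s)"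
      using bounded_bilinear.has_vector_derivative
        [OF bounded_bilinear_inner acceleration velocity', of s]
      by (simp add: has_real_derivative_iff_has_vector_derivative add.commute)
    then have "A s \<bullet> (\<xi> s - c) + T s \<bullet> T s = 0"
      unfolding tangent using DERIV_unique [OF _ DERIV_const] by fastforce
    moreover have "T s \<bullet> T s = 1" using unit_speed by (simp add: norm_eq_1)
    ultimately show ?thesis by linarith
  qed
  obtain \<epsilon> :: real where \<epsilon>: "\<epsilon> = 1 \<or> \<epsilon> = - 1" and A: "\<And>s. A s = (\<epsilon> * \<kappa> s) *\<^sub>R perp (T s)"
    using frenet by blast
  have curvature: "\<kappa> s = 1 / r" for s
  proof -
    define p where "p = (\<xi> s - c) \<bullet> perp (T s)"
    have pT: "p *\<^sub>R perp (T s) = \<xi> s - c"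
      using orthonormal_expansion [OF unit_speed, of "\<xi> s - c" s, symmetric] tangent [of s]
      by (simp add: p_def inner_commute)
    have "\<bar>p\<bar> = r"
      using arg_cong [OF pT, of norm] by (simp add: unit_speed on_sphere)
    moreover have "\<epsilon> * \<kappa> s * p = - 1"
      using normal [of s] by (simp add: A p_def inner_commute)
    then have "\<bar>\<epsilon>\<bar> * \<bar>\<kappa> s\<bar> * \<bar>p\<bar> = 1"
      by (simp add: abs_mult [symmetric])
    ultimately show ?thesis
      using \<epsilon> curvature_pos [of s] \<open>r > 0\<close> by (auto simp: field_simps)
  qed
  obtain z where "\<alpha> 1 - \<alpha> 0 = (1 - 0) * \<kappa> z"
    using MVT2 [of 0 1 \<alpha> \<kappa>] DERIV_angle by auto
  then show ?thesis
    by (simp add: curvature angle_zero total_curvature)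
qed

lemma circular_chord:
  assumes "\<And>s. \<kappa> s = 2 * pi"
  shows "norm (\<xi> x - \<xi> y) = \<bar>sin (pi * (x - y))\<bar> / pi"
proof -
  obtain c p where p: "\<bar>p\<bar> = 1 / (2 * pi)" and \<xi>: "\<And>s. \<xi> s = c + p *\<^sub>R perp (T s)"
    using circle_if_constant_curvature assms by metis
  have "((\<lambda>s. \<alpha> s - 2 * pi * s) has_real_derivative 0) (at s)" for s
    by (auto intro!: derivative_eq_intros DERIV_angle simp: assms)
  then have angle: "\<alpha> x - 2 * pi * x = \<alpha> y - 2 * pi * y"
    by (rule DERIV_isconst_all [rule_format])
  have "\<xi> x - \<xi> y = p *\<^sub>R perp (T x - T y)"
    using linear_diff [OF bounded_linear.linear [OF bounded_linear_perp]]
    by (simp add: \<xi> scaleR_diff_right)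
  then have "norm (\<xi> x - \<xi> y) = norm (T x - T y) / (2 * pi)"
    by (simp add: p)
  moreover have "(norm (T x - T y))\<^sup>2 = (2 * \<bar>sin (pi * (x - y))\<bar>)\<^sup>2"
  proof -
    have "(norm (T x - T y))\<^sup>2 = T x \<bullet> T x + T y \<bullet> T y - 2 * (T x \<bullet> T y)"
      by (simp add: power2_norm_eq_inner inner_diff_left inner_diff_right inner_commute)
    also have "\<dots> = 2 - 2 * cos (2 * (pi * (x - y)))"
    proof -
      have "\<alpha> x - \<alpha> y = 2 * (pi * (x - y))"
        using angle by (simp add: algebra_simps)
      then show ?thesis
        using unit_speed by (simp only: velocity_inner) simp
    qed
    also have "\<dots> = (2 * \<bar>sin (pi * (x - y))\<bar>)\<^sup>2"
      by (subst cos_double_sin) (simp add: power_mult_distrib)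
    finally show ?thesis .
  qed
  then have "norm (T x - T y) = 2 * \<bar>sin (pi * (x - y))\<bar>"
    by (rule power2_eq_imp_eq) auto
  ultimately show ?thesis by simp
qed

text \<open>
Among inscribed polygons of a circle the regular one is the longest. The tangent of the sine at
\<open>\<pi> / q\<close> bounds every chord, and its linear part sums to zero since the arcs add up to the perimeter.
\<close>

lemma circular_minimal_action_ge:
  assumes "\<And>s. \<kappa> s = 2 * pi" and "q \<ge> 2"
  shows "- (real q / pi * sin (pi / real q)) \<le> minimal_action \<xi> 1 q"
proof -
  define a where "a = pi / real q"
  have a: "0 < a" "a < pi" "real q * a = pi"
    using assms(2) by (auto simp: a_def field_simps)
  obtain x where x: "x \<in> pq_sequences 1 q" "action \<xi> q x = minimal_action \<xi> 1 q"
    using minimal_action_attained [OF continuous_position periodic, of 1 q] assms(2) by auto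
  have step: "x i \<le> x (Suc i)" "x (Suc i) \<le> x i + 1" if "i < q" for i
    using x(1) that by (auto simp: pq_sequences_def)
  have "(\<Sum>i<q. norm (\<xi> (x i) - \<xi> (x (Suc i))))
      \<le> (\<Sum>i<q. (sin a + cos a * (pi * (x (Suc i) - x i) - a)) / pi)"
  proof (rule sum_mono)
    fix i assume "i \<in> {..<q}"
    define l where "l = x (Suc i) - x i"
    have l: "0 \<le> pi * l" "pi * l \<le> pi"
      using step [of i] \<open>i \<in> {..<q}\<close> by (auto simp: l_def mult_le_cancel_left1)
    have "norm (\<xi> (x i) - \<xi> (x (Suc i))) = \<bar>sin (pi * l)\<bar> / pi"
      using circular_chord [OF assms(1), of "x (Suc i)" "x i"] by (simp add: l_def norm_minus_commute)
    also have "\<dots> \<le> (sin a + cos a * (pi * l - a)) / pi"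
      using sin_le_tangent [OF l a(1,2)] sin_ge_zero [OF l] by (intro divide_right_mono) auto
    finally show "norm (\<xi> (x i) - \<xi> (x (Suc i))) \<le> (sin a + cos a * (pi * (x (Suc i) - x i) - a)) / pi"
      by (simp add: l_def)
  qed
  also have "\<dots> = (real q * sin a + cos a * (pi * (\<Sum>i<q. x (Suc i) - x i) - real q * a)) / pi"
    by (simp add: sum_divide_distrib [symmetric] sum.distrib sum_distrib_left [symmetric] sum_subtractf)
  also have "(\<Sum>i<q. x (Suc i) - x i) = 1"
    using x(1) by (simp only: sum_lessThan_telescope) (simp add: pq_sequences_def)
  finally have "(\<Sum>i<q. norm (\<xi> (x i) - \<xi> (x (Suc i)))) \<le> real q / pi * sin a"
    by (simp add: a(3))
  then show ?thesis
    using x(2) by (simp add: action_def billiard_h_def sum_negf a_def)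
qed

section \<open>The coefficients of the expansion\<close>

text \<open>
The expansion is evaluated along \<open>h = 1 / q\<close>. The two bounds of the minimal action squeeze its limit,
which determines \<open>\<beta>\<^sub>1\<close>.
\<close>

lemma minimal_action_expansion:
  assumes "(\<lambda>h. billiard_beta \<xi> h - (\<beta>\<^sub>1 * h + \<beta>\<^sub>3 / fact 3 * h ^ 3)) \<in> o[at_right 0](\<lambda>h. h ^ 3)"
  shows "\<beta>\<^sub>1 = - 1"
    and "(\<lambda>q. (real q)\<^sup>2 * (minimal_action \<xi> 1 q + 1)) \<longlonglongrightarrow> \<beta>\<^sub>3 / 6"
proof -
  define m where "m = minimal_action \<xi> 1"
  have "filterlim (\<lambda>q. 1 / real q) (at_right 0) sequentially"
    by real_asymp
  with smalloD_tendsto [OF assms]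
  have "(\<lambda>q. (billiard_beta \<xi> (1 / real q) - (\<beta>\<^sub>1 * (1 / real q) + \<beta>\<^sub>3 / fact 3 * (1 / real q) ^ 3))
      / (1 / real q) ^ 3) \<longlonglongrightarrow> 0"
    by (rule filterlim_compose)
  moreover have "\<forall>\<^sub>F q in sequentially.
      (billiard_beta \<xi> (1 / real q) - (\<beta>\<^sub>1 * (1 / real q) + \<beta>\<^sub>3 / fact 3 * (1 / real q) ^ 3)) / (1 / real q) ^ 3
      = (real q)\<^sup>2 * (m q - \<beta>\<^sub>1) - \<beta>\<^sub>3 / 6"
    using eventually_gt_at_top [of 0]
  proof eventually_elim
    case (elim q)
    have "billiard_beta \<xi> (1 / real q) = m q / real q"
      using billiard_beta_rat_fraction [of q 1 \<xi>] elim by (simp add: m_def)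
    then show ?case
      using elim by (simp add: field_simps power2_eq_square power3_eq_cube fact_numeral)
  qed
  ultimately have "(\<lambda>q. (real q)\<^sup>2 * (m q - \<beta>\<^sub>1) - \<beta>\<^sub>3 / 6) \<longlonglongrightarrow> 0"
    using tendsto_cong by fast
  then have lim: "(\<lambda>q. (real q)\<^sup>2 * (m q - \<beta>\<^sub>1)) \<longlonglongrightarrow> \<beta>\<^sub>3 / 6"
    by (simp add: LIM_zero_iff)
  have "(\<lambda>q. (real q)\<^sup>2 * (m q - \<beta>\<^sub>1) * (1 / (real q)\<^sup>2)) \<longlonglongrightarrow> \<beta>\<^sub>3 / 6 * 0"
    by (rule tendsto_mult [OF lim]) real_asymp
  moreover have "\<forall>\<^sub>F q in sequentially. (real q)\<^sup>2 * (m q - \<beta>\<^sub>1) * (1 / (real q)\<^sup>2) = m q - \<beta>\<^sub>1"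
    using eventually_gt_at_top [of 0] by eventually_elim simp
  ultimately have "(\<lambda>q. m q - \<beta>\<^sub>1) \<longlonglongrightarrow> 0"
    using tendsto_cong by fastforce
  then have "m \<longlonglongrightarrow> \<beta>\<^sub>1"
    by (simp add: LIM_zero_iff)
  moreover have "m \<longlonglongrightarrow> - 1"
  proof -
    define C where "C = (4 * pi\<^sup>2 + 1) / 24"
    obtain Q where Q: "\<And>q. \<lbrakk>Q \<le> q; 0 < q\<rbrakk> \<Longrightarrow> (real q)\<^sup>2 * (m q + 1) \<le> C"
      using minimal_action_upper_bound [of 1 1 0 "4 * pi\<^sup>2"] defect_le by (force simp: m_def C_def)
    have upper: "\<forall>\<^sub>F q in sequentially. m q \<le> - 1 + C / (real q)\<^sup>2"
      using eventually_gt_at_top [of 0] eventually_ge_at_top [of Q]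
    proof eventually_elim
      case (elim q)
      then show ?case using Q [of q] by (simp add: field_simps)
    qed
    have lower: "\<forall>\<^sub>F q in sequentially. - 1 \<le> m q"
      using eventually_gt_at_top [of 0] by eventually_elim (unfold m_def, rule minimal_action_ge_perimeter)
    have "(\<lambda>q. - 1 + C / (real q)\<^sup>2) \<longlonglongrightarrow> - 1"
      by real_asymp
    then show ?thesis
      by (rule tendsto_sandwich [OF lower upper tendsto_const])
  qed
  ultimately show "\<beta>\<^sub>1 = - 1"
    by (rule LIMSEQ_unique)
  with lim show "(\<lambda>q. (real q)\<^sup>2 * (minimal_action \<xi> 1 q + 1)) \<longlonglongrightarrow> \<beta>\<^sub>3 / 6"
    by (simp add: m_def)
qed

lemma cubic_coefficient_le:
  assumes lim: "(\<lambda>q. (real q)\<^sup>2 * (minimal_action \<xi> 1 q + 1)) \<longlonglongrightarrow> L"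
    and "N > 0"
    and B: "\<And>s. \<lbrakk>x\<^sub>0 \<le> s; phase s \<le> phase x\<^sub>0 + 1 / real N\<rbrakk> \<Longrightarrow> defect s \<le> B"
  shows "L \<le> (4 * pi\<^sup>2 + (B - 4 * pi\<^sup>2) / real N) / 24"
proof (rule field_le_epsilon)
  fix e :: real assume "e > 0"
  obtain Q where Q: "\<And>m. \<lbrakk>Q \<le> m; 0 < m\<rbrakk> \<Longrightarrow> (real (m * N))\<^sup>2 * (minimal_action \<xi> 1 (m * N) + 1)
      \<le> (4 * pi\<^sup>2 + (B - 4 * pi\<^sup>2) / real N + 24 * e) / 24"
    using minimal_action_upper_bound [of "24 * e" N x\<^sub>0 B] \<open>e > 0\<close> \<open>N > 0\<close> B by auto
  have "filterlim (\<lambda>m. m * N) sequentially sequentially"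
    using \<open>N > 0\<close> by (intro filterlim_at_top_mono [OF filterlim_ident]) auto
  from filterlim_compose [OF lim this]
  have "L \<le> (4 * pi\<^sup>2 + (B - 4 * pi\<^sup>2) / real N + 24 * e) / 24"
  proof (rule tendsto_upperbound)
    show "\<forall>\<^sub>F m in sequentially. (real (m * N))\<^sup>2 * (minimal_action \<xi> 1 (m * N) + 1)
        \<le> (4 * pi\<^sup>2 + (B - 4 * pi\<^sup>2) / real N + 24 * e) / 24"
      using eventually_gt_at_top [of 0] eventually_ge_at_top [of Q] by eventually_elim (rule Q)
  qed simp
  then show "L \<le> (4 * pi\<^sup>2 + (B - 4 * pi\<^sup>2) / real N) / 24 + e"
    by (simp add: add_divide_distrib)
qed

text \<open>
By continuity the defect stays below some \<open>B < 4 \<pi>\<^sup>2\<close> right after \<open>x\<^sub>0\<close>, during an \<open>N\<close>-th part of the period for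
some \<open>N\<close>, which lowers the bound by a fixed amount.
\<close>

lemma cubic_coefficient_less_if_noncircular:
  assumes lim: "(\<lambda>q. (real q)\<^sup>2 * (minimal_action \<xi> 1 q + 1)) \<longlonglongrightarrow> L"
    and "\<kappa> x\<^sub>0 \<noteq> 2 * pi"
  shows "L < pi\<^sup>2 / 6"
proof -
  define B where "B = (defect x\<^sub>0 + 4 * pi\<^sup>2) / 2"
  have B: "defect x\<^sub>0 < B" "B < 4 * pi\<^sup>2"
    using defect_less [OF assms(2)] by (simp_all add: B_def)
  have "isCont defect x\<^sub>0"
    using continuous_defect [of UNIV] by (simp add: continuous_on_eq_continuous_at)
  then have "\<forall>\<^sub>F s in at x\<^sub>0. defect s < B"
    using B(1) by (intro order_tendstoD(2)) (auto simp: isCont_def)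
  then obtain d where d: "d > 0" "\<And>s. \<lbrakk>s \<noteq> x\<^sub>0; dist s x\<^sub>0 < d\<rbrakk> \<Longrightarrow> defect s < B"
    unfolding eventually_at by auto
  have "phase (x\<^sub>0 + d) - phase x\<^sub>0 > 0"
    using phase_strict_mono [of "x\<^sub>0" "x\<^sub>0 + d"] d(1) by simp
  then obtain n where n: "inverse (real (Suc n)) < phase (x\<^sub>0 + d) - phase x\<^sub>0"
    using reals_Archimedean by blast
  define N where "N = Suc n"
  have "defect s \<le> B" if "x\<^sub>0 \<le> s" "phase s \<le> phase x\<^sub>0 + 1 / real N" for s
  proof -
    have "phase s < phase (x\<^sub>0 + d)"
      using that(2) n unfolding N_def inverse_eq_divide by linarith
    then have "s < x\<^sub>0 + d" by (simp add: phase_less_iff)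
    then show ?thesis
      using that(1) d(2) [of s] B(1) by (cases "s = x\<^sub>0") (auto simp: dist_real_def)
  qed
  then have "L \<le> (4 * pi\<^sup>2 + (B - 4 * pi\<^sup>2) / real N) / 24"
    by (intro cubic_coefficient_le [OF lim]) (auto simp: N_def)
  moreover have "(B - 4 * pi\<^sup>2) / real N < 0"
    using B(2) by (simp add: N_def divide_neg_pos)
  ultimately show ?thesis by simp
qed

lemma cubic_coefficient_ge_if_circular:
  assumes "(\<lambda>q. (real q)\<^sup>2 * (minimal_action \<xi> 1 q + 1)) \<longlonglongrightarrow> L"
    and "\<And>s. \<kappa> s = 2 * pi"
  shows "pi\<^sup>2 / 6 \<le> L"
proof (rule tendsto_le [OF _ assms(1)])
  have "(\<lambda>q. (real q)\<^sup>2 * (1 - real q / pi * sin (pi / real q)))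
      \<longlonglongrightarrow> inverse pi * (pi * (pi * pi)) / 6"
    by real_asymp
  also have "inverse pi * (pi * (pi * pi)) / 6 = pi\<^sup>2 / 6"
    by (simp add: power2_eq_square field_simps)
  finally show "(\<lambda>q. (real q)\<^sup>2 * (1 - real q / pi * sin (pi / real q))) \<longlonglongrightarrow> pi\<^sup>2 / 6" .
  show "\<forall>\<^sub>F q in sequentially. (real q)\<^sup>2 * (1 - real q / pi * sin (pi / real q))
      \<le> (real q)\<^sup>2 * (minimal_action \<xi> 1 q + 1)"
    using eventually_ge_at_top [of 2]
  proof eventually_elim
    case (elim q)
    then show ?case
      using circular_minimal_action_ge [OF assms(2) elim] by (intro mult_left_mono) auto
  qed
qed simp

end

theorem corollary1p16:
  fixes \<Omega> :: "(real^2) set" and \<xi> :: "real \<Rightarrow> real^2" and \<beta>\<^sub>1 \<beta>\<^sub>3 :: real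
  assumes "open \<Omega>" and "connected \<Omega>" and "\<Omega> \<noteq> {}" and "bounded \<Omega>"
    and "strictly_convex \<Omega>"
    and "arc_length_param \<xi> (frontier \<Omega>)"
    and "\<And>s. curvature \<xi> s > 0"
    and "(\<lambda>h. billiard_beta \<xi> h - (\<beta>\<^sub>1 * h + \<beta>\<^sub>3 / fact 3 * h ^ 3)) \<in> o[at_right 0](\<lambda>h. h ^ 3)"
  shows "\<beta>\<^sub>3 + pi\<^sup>2 * \<beta>\<^sub>1 \<le> 0 \<and>
    (\<beta>\<^sub>3 + pi\<^sup>2 * \<beta>\<^sub>1 = 0 \<longleftrightarrow> (\<exists>c r. r > 0 \<and> \<Omega> = ball c r))"
proof -
  define T where "T = curve_deriv \<xi>"
  define A where "A = curve_deriv T"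
  note param = assms(6) [unfolded arc_length_param_def]
  have "((curve_deriv ^^ k) \<xi>) differentiable (at s)" for k s
    using param unfolding smooth_curve_def by blast
  from this [of 0] this [of 1] this [of 2]
  have diff: "\<xi> differentiable (at s)" "T differentiable (at s)" "A differentiable (at s)" for s
    by (simp_all add: T_def A_def numeral_2_eq_2)
  interpret convex_table \<xi> T A \<Omega>
  proof
    show "(\<xi> has_vector_derivative T s) (at s)" "(T has_vector_derivative A s) (at s)" for s
      using diff [of s] by (simp_all add: T_def A_def curve_deriv_def vector_derivative_works)
    show "continuous_on UNIV A"
      using diff(3) by (simp add: continuous_on_eq_continuous_at differentiable_imp_continuous_within)
    show "A s \<noteq> 0" for s
      using assms(7) [of s] by (simp add: curvature_def A_def T_def)
  qed (use assms param in \<open>auto simp: T_def\<close>)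
  note expansion = minimal_action_expansion [OF assms(8)]
  have le: "\<beta>\<^sub>3 \<le> pi\<^sup>2"
    using cubic_coefficient_le [OF expansion(2), of 1 0 "4 * pi\<^sup>2"] defect_le by simp
  have "\<beta>\<^sub>3 = pi\<^sup>2 \<longleftrightarrow> (\<exists>c r. r > 0 \<and> \<Omega> = ball c r)"
  proof
    assume "\<beta>\<^sub>3 = pi\<^sup>2"
    then have "\<kappa> s = 2 * pi" for s
      using cubic_coefficient_less_if_noncircular [OF expansion(2), of s] by auto
    then show "\<exists>c r. r > 0 \<and> \<Omega> = ball c r"
      using disc_if_constant_curvature by metis
  next
    assume "\<exists>c r. r > 0 \<and> \<Omega> = ball c r"
    then have "\<kappa> s = 2 * pi" for s
      using disc_imp_constant_curvature by blast
    then have "pi\<^sup>2 / 6 \<le> \<beta>\<^sub>3 / 6"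
      by (rule cubic_coefficient_ge_if_circular [OF expansion(2)])
    with le show "\<beta>\<^sub>3 = pi\<^sup>2" by simp
  qed
  with le show ?thesis by (simp add: expansion(1))
qed

end
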